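(* Let $D=(d_{ij})$ be an $n\times n$, $n\ge 3$, Euclidean distance matrix of embedding dimension $r\le n-2$, and let $Z$ and $P$ be, respectively, a Gale matrix and a configuration matrix of $D$, where $P^Te=0$. Let $(z^i)^T$ and $(p^i)^T$ denote the $i$th rows of $Z$ and $P$, let $S=P(P^TP)^{-1}$, and let $(s^i)^T$ be the $i$th row of $S$, i.e., $s^i=(P^TP)^{-1}p^i$. Let $k\ne l$ be indices in $\{1,\ldots,n\}$. If both $z^k$ and $z^l$ are nonzero and $z^k=c\,z^l$ for some nonzero scalar $c$, then the yielding interval of the entry $d_{kl}$ is $$\left[\frac{-4c}{\|s^k-c\,s^l\|^2},\ 0\right]\quad\text{if } c>0,$$ and $$\left[0,\ \frac{4|c|}{\|s^k-c\,s^l\|^2}\right]\quad\text{if } c<0.$$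
   Context: An $n\times n$ real matrix $D=(d_{ij})$ is a Euclidean distance matrix (EDM) if there exist points $p^1,\ldots,p^n$ in some Euclidean space with $d_{ij}=\|p^i-p^j\|^2$ for all $i,j$; the dimension of the affine span of such points is the embedding dimension $r$ of $D$. For $i\ne j$, $E^{ij}$ is the $n\times n$ symmetric matrix with 1's in the $ij$th and $ji$th entries and 0's elsewhere. The yielding interval of an off-diagonal entry $d_{ij}$ is the closed interval $[l_{ij},u_{ij}]$ such that $D+tE^{ij}$ is an EDM if and only if $l_{ij}\le t\le u_{ij}$. Let $e\in\mathbb{R}^n$ be the all-ones vector, $J=I_n-ee^T/n$, and $B=-\frac12 JDJ$, which is positive semidefinite of rank $r$. A configuration matrix of $D$ is an $n\times r$ matrix $P$ with $B=PP^T$ (so $P$ has rank $r$ and $P^Te=0$); its rows $(p^1)^T,\ldots,(p^n)^T$ give generating points of $D$. For $r\le n-2$, a Gale matrix of $D$ is an $n\times(n-r-1)$ matrix $Z$ whose columns form a basis of the null space of $\begin{bmatrix}P^T\\ e^T\end{bmatrix}$ (equivalently of $\begin{bmatrix}B\\ e^T\end{bmatrix}$). *)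

theory Defs
  imports
    "Jordan_Normal_Form.Matrix_Kernel"
    "Jordan_Normal_Form.Gauss_Jordan_Elimination"
begin

text \<open>Indices are zero-based: $\{1,\dots,n\}$ becomes \<open>{..<n}\<close>. A system of points
  $p^1,\dots,p^n$ of $\mathbb{R}^m$ is given by the matrix in \<open>carrier_mat n m\<close> whose rows are
  the points.\<close>

definition norm_sq :: "real vec \<Rightarrow> real" where
  "norm_sq v = v \<bullet> v"

definition ones_vec :: "nat \<Rightarrow> real vec" where
  "ones_vec n = vec n (\<lambda>_. 1)"

definition generates_edm :: "real mat \<Rightarrow> real mat \<Rightarrow> bool" where
  "generates_edm X D \<longleftrightarrow>
     D \<in> carrier_mat (dim_row X) (dim_row X) \<and>
     (\<forall>i<dim_row X. \<forall>j<dim_row X. D $$ (i, j) = norm_sq (row X i - row X j))"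

definition is_edm :: "nat \<Rightarrow> real mat \<Rightarrow> bool" where
  "is_edm n D \<longleftrightarrow> (\<exists>m. \<exists>X\<in>carrier_mat n m. generates_edm X D)"

definition affine_span_rows :: "real mat \<Rightarrow> real vec set" where
  "affine_span_rows X =
     {transpose_mat X *\<^sub>v a | a. a \<in> carrier_vec (dim_row X) \<and> (\<Sum>i<dim_row X. a $ i) = 1}"

text \<open>The dimension of an affine set is that of its direction space, the linear space of all
  differences of two of its elements.\<close>

definition affine_dim_rows :: "real mat \<Rightarrow> nat" where
  "affine_dim_rows X =
     vectorspace.dim class_ring
       ((module_vec TYPE(real) (dim_col X))
          \<lparr>carrier := {x - y | x y. x \<in> affine_span_rows X \<and> y \<in> affine_span_rows X}\<rparr>)"

text \<open>The dimension of the affine span depends only on the pairwise distances, so it does not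
  matter which generating points are used.\<close>

definition has_embedding_dim :: "real mat \<Rightarrow> nat \<Rightarrow> bool" where
  "has_embedding_dim D r \<longleftrightarrow> (\<exists>X. generates_edm X D \<and> affine_dim_rows X = r)"

definition sym_unit_mat :: "nat \<Rightarrow> nat \<Rightarrow> nat \<Rightarrow> real mat" where
  "sym_unit_mat n i j = mat n n (\<lambda>p. if p = (i, j) \<or> p = (j, i) then 1 else 0)"

definition is_yielding_interval :: "nat \<Rightarrow> real mat \<Rightarrow> nat \<Rightarrow> nat \<Rightarrow> real \<Rightarrow> real \<Rightarrow> bool" where
  "is_yielding_interval n D i j lo up \<longleftrightarrow>
     (\<forall>t. is_edm n (D + t \<cdot>\<^sub>m sym_unit_mat n i j) \<longleftrightarrow> lo \<le> t \<and> t \<le> up)"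

definition centering_mat :: "nat \<Rightarrow> real mat" where
  "centering_mat n = 1\<^sub>m n - mat n n (\<lambda>_. 1 / real n)"

definition gram_of_edm :: "nat \<Rightarrow> real mat \<Rightarrow> real mat" where
  "gram_of_edm n D = (- 1 / 2) \<cdot>\<^sub>m (centering_mat n * D * centering_mat n)"

text \<open>In the next two definitions \<open>r\<close> is meant to be the embedding dimension of \<open>D\<close>.\<close>

definition is_configuration_mat :: "nat \<Rightarrow> nat \<Rightarrow> real mat \<Rightarrow> real mat \<Rightarrow> bool" where
  "is_configuration_mat n r D P \<longleftrightarrow>
     P \<in> carrier_mat n r \<and> gram_of_edm n D = P * transpose_mat P"

text \<open>The null space below is that of the $(r+1) \times n$ matrix with blocks $P^T$ and $e^T$. It
  is the same for all configuration matrices of \<open>D\<close>. Since the columns form a basis as a family,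
  they must also be distinct.\<close>

definition is_gale_mat :: "nat \<Rightarrow> nat \<Rightarrow> real mat \<Rightarrow> real mat \<Rightarrow> bool" where
  "is_gale_mat n r D Z \<longleftrightarrow>
     Z \<in> carrier_mat n (n - r - 1) \<and>
     (\<exists>P. is_configuration_mat n r D P \<and>
        distinct (cols Z) \<and>
        vectorspace.basis class_ring
          ((module_vec TYPE(real) n)
             \<lparr>carrier := mat_kernel (transpose_mat P @\<^sub>r mat_of_row (ones_vec n))\<rparr>)
          (set (cols Z)))"

text \<open>This is $S = P (P^T P)^{-1}$. The inverse exists for configuration matrices, which have
  full column rank; otherwise \<open>mat_inverse\<close> yields \<open>None\<close> and the value is unspecified.\<close>

definition config_pinv :: "real mat \<Rightarrow> real mat" where
  "config_pinv P = P * the (mat_inverse (transpose_mat P * P))"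

end

theory Submission
  imports Defs
begin

text \<open>
  Let \<open>e\<close> be the all-ones vector, \<open>d\<close> the difference of the \<open>k\<close>-th unit vector and \<open>c\<close> times the
  \<open>l\<close>-th one, \<open>s = S\<^sup>T d\<close> (which is $s^k - c\,s^l$) and \<open>N\<close> its squared norm.

  A symmetric perturbation by \<open>t\<close> of the entry at \<open>(k, l)\<close> changes the quadratic form of \<open>D\<close> at \<open>x\<close>
  by \<open>2 t x\<^sub>k x\<^sub>l\<close>. On the hyperplane orthogonal to \<open>e\<close> the quadratic form of an EDM is \<open>- 2\<close> times
  the squared norm of \<open>X\<^sup>T x\<close>, for any points \<open>X\<close> generating it (\<open>edm_quadratic_form\<close>). Hence a
  perturbed matrix that is still an EDM satisfies, for all \<open>x\<close> orthogonal to \<open>e\<close>,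
  \<open>t x\<^sub>k x\<^sub>l \<le> norm_sq (P\<^sup>T x)\<close> (\<open>perturbed_edm_necessary\<close>).

  That the Gale vectors are parallel says that \<open>d\<close> is orthogonal to all columns of \<open>Z\<close>. These columns
  span the orthogonal complement of the columns of \<open>P\<close> together with \<open>e\<close>, so
  \<open>d = P s + \<beta> e\<close> for some number \<open>\<beta>\<close> (\<open>gale_orthogonal_decomposition\<close>). So for \<open>x\<close> orthogonal
  to \<open>e\<close>, \<open>x\<^sub>k - c x\<^sub>l = s \<bullet> P\<^sup>T x\<close>, and \<open>4 c x\<^sub>k x\<^sub>l\<close>, as a difference of squares, is
  \<open>(x\<^sub>k + c x\<^sub>l)\<^sup>2 - (s \<bullet> P\<^sup>T x)\<^sup>2\<close>. With \<open>\<theta> = - t N / (4 c)\<close> the perturbed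
  form is, up to the factor \<open>- 2\<close>,
  \<open>norm_sq (P\<^sup>T x) - \<theta> (s \<bullet> P\<^sup>T x)\<^sup>2 / N + \<theta> (x\<^sub>k + c x\<^sub>l)\<^sup>2 / N\<close>.

  If \<open>0 \<le> \<theta> \<le> 1\<close>, this is a sum of squares, and it can be read off as a set of points: shrink the
  configuration in the direction of \<open>s\<close> by the factor \<open>sqrt (1 - \<theta>)\<close> and add one coordinate
  (\<open>exchange_coordinate_edm\<close>). Conversely, a column of \<open>Z\<close>, where \<open>P\<^sup>T x = 0\<close>, forces \<open>\<theta> \<ge> 0\<close>, and a
  vector with \<open>P\<^sup>T x = s\<close> and \<open>x\<^sub>k + c x\<^sub>l = 0\<close> forces \<open>\<theta> \<le> 1\<close>
  (\<open>edm_perturbation_iff\<close>). Solving \<open>0 \<le> \<theta> \<le> 1\<close> for \<open>t\<close> gives the two intervals.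
\<close>

section \<open>Squared norms and kernels\<close>

lemma norm_sq_eq_sum: "norm_sq v = (\<Sum>m<dim_vec v. (v $ m)\<^sup>2)"
  by (simp add: norm_sq_def scalar_prod_def power2_eq_square atLeast0LessThan)

lemma norm_sq_nonneg: "0 \<le> norm_sq v"
  by (simp add: norm_sq_eq_sum sum_nonneg)

lemma norm_sq_eq_0_iff:
  assumes "v \<in> carrier_vec n"
  shows "norm_sq v = 0 \<longleftrightarrow> v = 0\<^sub>v n"
proof
  assume "norm_sq v = 0"
  then have "\<forall>m<dim_vec v. (v $ m)\<^sup>2 = 0"
    unfolding norm_sq_eq_sum by (subst (asm) sum_nonneg_eq_0_iff) auto
  then show "v = 0\<^sub>v n" using assms by auto
qed (simp add: norm_sq_def)

lemma norm_sq_diff: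
  assumes "v \<in> carrier_vec n" "w \<in> carrier_vec n"
  shows "norm_sq (v - w) = norm_sq v + norm_sq w - 2 * (v \<bullet> w)"
  using assms
  by (simp add: norm_sq_def scalar_prod_minus_distrib[of _ n] minus_scalar_prod_distrib[of _ n]
      comm_scalar_prod[of w n v])

lemma norm_sq_transpose_mult:
  fixes A :: "real mat"
  assumes A: "A \<in> carrier_mat n r" and x: "x \<in> carrier_vec n"
  shows "norm_sq (A\<^sup>T *\<^sub>v x) = x \<bullet> (A *\<^sub>v (A\<^sup>T *\<^sub>v x))"
  unfolding norm_sq_def by (rule transpose_vec_mult_scalar[OF A _ x]) (use A x in auto)

lemma kernel_gram_eq:
  fixes A :: "real mat"
  assumes A: "A \<in> carrier_mat n r" and x: "x \<in> carrier_vec n"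
  shows "(A * A\<^sup>T) *\<^sub>v x = 0\<^sub>v n \<longleftrightarrow> A\<^sup>T *\<^sub>v x = 0\<^sub>v r"
proof -
  have At: "A\<^sup>T \<in> carrier_mat r n" using A by simp
  have assoc: "(A * A\<^sup>T) *\<^sub>v x = A *\<^sub>v (A\<^sup>T *\<^sub>v x)"
    by (rule assoc_mult_mat_vec[OF A At x])
  show ?thesis
  proof
    assume "(A * A\<^sup>T) *\<^sub>v x = 0\<^sub>v n"
    then have "norm_sq (A\<^sup>T *\<^sub>v x) = 0"
      using x unfolding norm_sq_transpose_mult[OF A x] assoc by simp
    then show "A\<^sup>T *\<^sub>v x = 0\<^sub>v r" using norm_sq_eq_0_iff[of "A\<^sup>T *\<^sub>v x" r] At x by auto
  next
    assume "A\<^sup>T *\<^sub>v x = 0\<^sub>v r"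
    then show "(A * A\<^sup>T) *\<^sub>v x = 0\<^sub>v n" unfolding assoc using A by auto
  qed
qed

lemma ones_vec_carrier [simp]: "ones_vec n \<in> carrier_vec n"
  by (simp add: ones_vec_def)

lemma ones_vec_scalar_prod:
  assumes "x \<in> carrier_vec n"
  shows "ones_vec n \<bullet> x = (\<Sum>i<n. x $ i)"
  using assms by (simp add: ones_vec_def scalar_prod_def atLeast0LessThan)

section \<open>Distances and Gram matrices\<close>

text \<open>Multiplication by the centering matrix on the left and on the right subtracts the row and
  the column means and adds back the mean of all entries.\<close>

lemma gram_of_edm_index:
  assumes D: "D \<in> carrier_mat n n" and i: "i < n" and j: "j < n"
  shows "gram_of_edm n D $$ (i, j) =
    - (D $$ (i, j) - (\<Sum>b<n. D $$ (i, b)) / n - (\<Sum>a<n. D $$ (a, j)) / n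
       + (\<Sum>a<n. \<Sum>b<n. D $$ (a, b)) / n\<^sup>2) / 2"
proof -
  define C where "C = mat n n (\<lambda>_. 1 / real n)"
  have C: "C \<in> carrier_mat n n" by (simp add: C_def)
  have J: "centering_mat n = 1\<^sub>m n - C" by (simp add: centering_mat_def C_def)
  have one: "(1\<^sub>m n :: real mat) \<in> carrier_mat n n" by simp
  have CD: "C * D \<in> carrier_mat n n" and DC: "D * C \<in> carrier_mat n n"
    and CDC: "C * D * C \<in> carrier_mat n n" using C D by auto
  have DCD: "D - C * D \<in> carrier_mat n n" by (rule minus_carrier_mat[OF CD])
  have "centering_mat n * D = D - C * D"
    unfolding J using minus_mult_distrib_mat[OF one C D] left_mult_one_mat[OF D] by simp
  then have "centering_mat n * D * centering_mat n = (D - C * D) * (1\<^sub>m n - C)"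
    unfolding J by simp
  also have "\<dots> = (D - C * D) * 1\<^sub>m n - (D - C * D) * C"
    by (rule mult_minus_distrib_mat[OF DCD one C])
  also have "(D - C * D) * 1\<^sub>m n = D - C * D"
    by (rule right_mult_one_mat[OF DCD])
  also have "(D - C * D) * C = D * C - C * D * C"
    by (rule minus_mult_distrib_mat[OF D CD C])
  finally have exp: "centering_mat n * D * centering_mat n = D - C * D - (D * C - C * D * C)" .
  have CD_i: "(C * D) $$ (a, b) = (\<Sum>m<n. D $$ (m, b)) / n" if "a < n" "b < n" for a b
    using that C D by (simp add: scalar_prod_def C_def sum_divide_distrib atLeast0LessThan)
  have DC_i: "(D * C) $$ (a, b) = (\<Sum>m<n. D $$ (a, m)) / n" if "a < n" "b < n" for a b
    using that C D by (simp add: scalar_prod_def C_def sum_divide_distrib atLeast0LessThan)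
  have "(C * D * C) $$ (i, j) = row (C * D) i \<bullet> col C j"
    by (rule index_mult_mat(1)) (use i j CD C in auto)
  also have "\<dots> = (\<Sum>b<n. (C * D) $$ (i, b) * C $$ (b, j))"
    using i j CD C
    by (auto simp: scalar_prod_def atLeast0LessThan simp del: index_mult_mat(1) intro!: sum.cong)
  also have "\<dots> = (\<Sum>b<n. (\<Sum>a<n. D $$ (a, b)) / n * (1 / n))"
    using i j CD_i by (intro sum.cong) (auto simp: C_def)
  also have "\<dots> = (\<Sum>b<n. \<Sum>a<n. D $$ (a, b)) / n\<^sup>2"
    by (simp add: sum_divide_distrib power2_eq_square)
  also have "(\<Sum>b<n. \<Sum>a<n. D $$ (a, b)) = (\<Sum>a<n. \<Sum>b<n. D $$ (a, b))"
    by (rule sum.swap)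
  finally have CDC_i: "(C * D * C) $$ (i, j) = (\<Sum>a<n. \<Sum>b<n. D $$ (a, b)) / n\<^sup>2" .
  have "gram_of_edm n D $$ (i, j)
      = (- 1 / 2) * (D $$ (i, j) - (C * D) $$ (i, j) - ((D * C) $$ (i, j) - (C * D * C) $$ (i, j)))"
    unfolding gram_of_edm_def exp using i j D C
    by (simp del: index_mult_mat(1))
  moreover have "(- 1 / 2) * (u - v - (w - z)) = - (u - w - v + z) / 2" for u v w z :: real
    by (simp add: field_simps)
  ultimately show ?thesis
    unfolding CDC_i CD_i[OF i j] DC_i[OF i j] by (simp only:)
qed

text \<open>The expression \<open>B\<^sub>i\<^sub>i + B\<^sub>j\<^sub>j - 2 B\<^sub>i\<^sub>j\<close> for the squared distances of the rows of \<open>P\<close> returns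
  \<open>D\<^sub>i\<^sub>j\<close>, since the means cancel: an EDM is symmetric, so that row and column means agree, and has
  zero diagonal.\<close>

lemma configuration_mat_generates_edm:
  assumes edm: "is_edm n D" and conf: "is_configuration_mat n r D P"
  shows "generates_edm P D"
proof -
  obtain m X where X: "X \<in> carrier_mat n m" and gen: "generates_edm X D"
    using edm unfolding is_edm_def by blast
  have D: "D \<in> carrier_mat n n"
    and Dx: "\<And>i j. i < n \<Longrightarrow> j < n \<Longrightarrow> D $$ (i, j) = norm_sq (row X i - row X j)"
    using X gen by (auto simp: generates_edm_def)
  have P: "P \<in> carrier_mat n r" and B: "gram_of_edm n D = P * P\<^sup>T"
    using conf by (auto simp: is_configuration_mat_def)
  have sym: "D $$ (i, j) = D $$ (j, i)" if "i < n" "j < n" for i j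
  proof -
    have "row X i \<in> carrier_vec m" "row X j \<in> carrier_vec m" using X that by auto
    then show ?thesis
      using that by (simp add: Dx norm_sq_diff comm_scalar_prod[of "row X i" m "row X j"])
  qed
  have diag: "D $$ (i, i) = 0" if "i < n" for i
  proof -
    have "row X i \<in> carrier_vec m" using X that by auto
    then show ?thesis using that by (simp add: Dx norm_sq_diff) (simp add: norm_sq_def)
  qed
  have B_index: "gram_of_edm n D $$ (i, j) = row P i \<bullet> row P j" if "i < n" "j < n" for i j
    using that P unfolding B by auto
  have col_sum: "(\<Sum>a<n. D $$ (a, i)) = (\<Sum>b<n. D $$ (i, b))" if "i < n" for i
    using sym that by (intro sum.cong) auto
  have "D $$ (i, j) = norm_sq (row P i - row P j)" if i: "i < n" and j: "j < n" for i j
  proof -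
    have "row P i \<in> carrier_vec r" "row P j \<in> carrier_vec r" using P that by auto
    then have "norm_sq (row P i - row P j) = gram_of_edm n D $$ (i, i) + gram_of_edm n D $$ (j, j)
        - 2 * gram_of_edm n D $$ (i, j)"
      using i j by (simp add: norm_sq_diff B_index) (simp add: norm_sq_def)
    also have "\<dots> = D $$ (i, j)"
    proof -
      have "- (0 - a - a + z) / 2 + - (0 - b - b + z) / 2 - 2 * (- (u - a - b + z) / 2) = u"
        for a b u z :: real by (simp add: field_simps)
      then show ?thesis
        unfolding gram_of_edm_index[OF D i i] gram_of_edm_index[OF D j j] gram_of_edm_index[OF D i j]
          diag[OF i] diag[OF j] col_sum[OF i] col_sum[OF j] .
    qed
    finally show ?thesis by simp
  qed
  then show ?thesis using P D by (auto simp: generates_edm_def)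
qed

text \<open>Expanding each squared distance gives two terms that depend on one index only and are killed by
  the condition that the entries of \<open>x\<close> sum to zero, and \<open>- 2\<close> times the Gram matrix.\<close>

lemma edm_quadratic_form:
  assumes X: "X \<in> carrier_mat n m" and gen: "generates_edm X D"
    and x: "x \<in> carrier_vec n" and sum0: "ones_vec n \<bullet> x = 0"
  shows "x \<bullet> (D *\<^sub>v x) = - 2 * norm_sq (X\<^sup>T *\<^sub>v x)"
proof -
  have D: "D \<in> carrier_mat n n" using X gen by (auto simp: generates_edm_def)
  define y where "y = X\<^sup>T *\<^sub>v x"
  have y: "y \<in> carrier_vec m" using X x by (auto simp: y_def)
  have s0: "(\<Sum>j<n. x $ j) = 0" using sum0 ones_vec_scalar_prod[OF x] by simp
  define \<gamma> where "\<gamma> = (\<Sum>j<n. norm_sq (row X j) * x $ j)"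
  have inner: "(\<Sum>j<n. (row X i \<bullet> row X j) * x $ j) = row X i \<bullet> y" if "i < n" for i
  proof -
    have G: "X * X\<^sup>T \<in> carrier_mat n n" and Xt: "X\<^sup>T \<in> carrier_mat m n" using X by auto
    have "(\<Sum>j<n. (row X i \<bullet> row X j) * x $ j) = ((X * X\<^sup>T) *\<^sub>v x) $ i"
      using that X x G by (simp add: scalar_prod_def[of _ x] atLeast0LessThan del: assoc_mult_mat_vec)
    also have "(X * X\<^sup>T) *\<^sub>v x = X *\<^sub>v y"
      unfolding y_def by (rule assoc_mult_mat_vec[OF X Xt x])
    finally show ?thesis using that X by simp
  qed
  have Dx: "(D *\<^sub>v x) $ i = \<gamma> - 2 * (X *\<^sub>v y) $ i" if i: "i < n" for i
  proof -
    have ent: "D $$ (i, j) = norm_sq (row X i) + norm_sq (row X j) - 2 * (row X i \<bullet> row X j)"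
      if j: "j < n" for j
    proof -
      have "row X i \<in> carrier_vec m" "row X j \<in> carrier_vec m" using X i j by auto
      then show ?thesis using gen X i j by (simp add: generates_edm_def norm_sq_diff[of _ m])
    qed
    have "(D *\<^sub>v x) $ i = (\<Sum>j<n. D $$ (i, j) * x $ j)"
      using D x i by (simp add: scalar_prod_def atLeast0LessThan)
    also have "\<dots> = (\<Sum>j<n. norm_sq (row X i) * x $ j + norm_sq (row X j) * x $ j
        - 2 * ((row X i \<bullet> row X j) * x $ j))"
      by (intro sum.cong) (auto simp: ent algebra_simps)
    also have "\<dots> = norm_sq (row X i) * (\<Sum>j<n. x $ j) + \<gamma>
        - 2 * (\<Sum>j<n. (row X i \<bullet> row X j) * x $ j)"
      by (simp add: sum.distrib sum_subtractf sum_distrib_left \<gamma>_def)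
    finally show ?thesis using i X by (simp add: s0 inner)
  qed
  have "x \<bullet> (D *\<^sub>v x) = (\<Sum>i<n. x $ i * (\<gamma> - 2 * (X *\<^sub>v y) $ i))"
    using D by (simp add: scalar_prod_def[of x] Dx atLeast0LessThan del: index_mult_mat_vec)
  also have "\<dots> = \<gamma> * (\<Sum>i<n. x $ i) - 2 * (\<Sum>i<n. x $ i * (X *\<^sub>v y) $ i)"
    by (simp add: sum_subtractf sum_distrib_left algebra_simps del: index_mult_mat_vec)
  also have "(\<Sum>i<n. x $ i * (X *\<^sub>v y) $ i) = x \<bullet> (X *\<^sub>v y)"
    using X by (simp add: scalar_prod_def[of x] atLeast0LessThan del: index_mult_mat_vec)
  also have "x \<bullet> (X *\<^sub>v y) = norm_sq y"
    unfolding y_def by (rule norm_sq_transpose_mult[OF X x, symmetric])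
  finally show ?thesis by (simp add: s0 y_def)
qed

lemma sym_unit_mat_mult_index:
  assumes "x \<in> carrier_vec n" "k < n" "l < n" "k \<noteq> l" "i < n"
  shows "(sym_unit_mat n k l *\<^sub>v x) $ i = of_bool (i = k) * x $ l + of_bool (i = l) * x $ k"
proof -
  have "(sym_unit_mat n k l *\<^sub>v x) $ i =
      (\<Sum>j<n. (if j = l then of_bool (i = k) * x $ l else 0)
         + (if j = k then of_bool (i = l) * x $ k else 0))"
    using assms unfolding sym_unit_mat_def
    by (auto simp: scalar_prod_def atLeast0LessThan if_distrib[where f = "\<lambda>z. z * _"]
        cong: if_cong)
  also have "\<dots> = of_bool (i = k) * x $ l + of_bool (i = l) * x $ k"
    using assms by (simp add: sum.distrib)
  finally show ?thesis .
qed

lemma sym_unit_mat_quadratic_form: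
  assumes x: "x \<in> carrier_vec n" and "k < n" "l < n" "k \<noteq> l"
  shows "x \<bullet> (sym_unit_mat n k l *\<^sub>v x) = 2 * (x $ k * x $ l)"
proof -
  have "x \<bullet> (sym_unit_mat n k l *\<^sub>v x) =
      (\<Sum>i<n. x $ i * (sym_unit_mat n k l *\<^sub>v x) $ i)"
    by (simp add: scalar_prod_def[of x] atLeast0LessThan sym_unit_mat_def
        del: index_mult_mat_vec)
  also have "\<dots> = (\<Sum>i<n. (if i = k then x $ k * x $ l else 0)
         + (if i = l then x $ k * x $ l else 0))"
    using sym_unit_mat_mult_index[OF assms] by (intro sum.cong) auto
  also have "\<dots> = 2 * (x $ k * x $ l)" using assms by (simp add: sum.distrib)
  finally show ?thesis .
qed

lemma smult_mat_mult_vec: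
  fixes A :: "real mat"
  assumes "A \<in> carrier_mat m n" "x \<in> carrier_vec n"
  shows "(t \<cdot>\<^sub>m A) *\<^sub>v x = t \<cdot>\<^sub>v (A *\<^sub>v x)"
  by (rule eq_vecI) (use assms in auto)

lemma perturbed_edm_necessary:
  assumes P: "P \<in> carrier_mat n r" and gen: "generates_edm P D"
    and kl: "k < n" "l < n" "k \<noteq> l"
    and edm: "is_edm n (D + t \<cdot>\<^sub>m sym_unit_mat n k l)"
    and x: "x \<in> carrier_vec n" and sum0: "ones_vec n \<bullet> x = 0"
  shows "t * (x $ k * x $ l) \<le> norm_sq (P\<^sup>T *\<^sub>v x)"
proof -
  have D: "D \<in> carrier_mat n n" using P gen by (auto simp: generates_edm_def)
  have E: "sym_unit_mat n k l \<in> carrier_mat n n" by (simp add: sym_unit_mat_def)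
  obtain m X where X: "X \<in> carrier_mat n m"
    and genX: "generates_edm X (D + t \<cdot>\<^sub>m sym_unit_mat n k l)"
    using edm unfolding is_edm_def by blast
  have "(D + t \<cdot>\<^sub>m sym_unit_mat n k l) *\<^sub>v x
      = D *\<^sub>v x + t \<cdot>\<^sub>v (sym_unit_mat n k l *\<^sub>v x)"
    using add_mult_distrib_mat_vec[OF D _ x, of "t \<cdot>\<^sub>m sym_unit_mat n k l"] E
    by (simp add: smult_mat_mult_vec[OF E x])
  moreover have "D *\<^sub>v x \<in> carrier_vec n" "sym_unit_mat n k l *\<^sub>v x \<in> carrier_vec n"
    using D E x by auto
  ultimately have "x \<bullet> ((D + t \<cdot>\<^sub>m sym_unit_mat n k l) *\<^sub>v x)
      = x \<bullet> (D *\<^sub>v x) + t * (x \<bullet> (sym_unit_mat n k l *\<^sub>v x))"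
    using x by (simp add: scalar_prod_add_distrib[of _ n])
  then have "- 2 * norm_sq (X\<^sup>T *\<^sub>v x) = - 2 * norm_sq (P\<^sup>T *\<^sub>v x) + 2 * (t * (x $ k * x $ l))"
    unfolding edm_quadratic_form[OF X genX x sum0] edm_quadratic_form[OF P gen x sum0]
      sym_unit_mat_quadratic_form[OF x kl] by simp
  then show ?thesis using norm_sq_nonneg[of "X\<^sup>T *\<^sub>v x"] by linarith
qed

text \<open>The points are \<open>p\<^sup>i - \<mu> (p\<^sup>i \<bullet> s) s\<close> with the extra coordinate \<open>\<nu> g\<^sub>i\<close>. Here \<open>\<mu>\<close> is chosen so that the
  component along \<open>s\<close> is scaled by \<open>sqrt (1 - \<theta>)\<close>, which removes the fraction \<open>\<theta>\<close> of its contribution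
  \<open>(f\<^sub>i - f\<^sub>j)\<^sup>2 / norm_sq s\<close> to the squared distances. The coordinate \<open>g\<close>, scaled to the same unit,
  takes its place. The constant \<open>\<beta>\<close> drops out of all differences.\<close>

lemma exchange_coordinate_edm:
  assumes P: "P \<in> carrier_mat n r" and gen: "generates_edm P D"
    and s: "s \<in> carrier_vec r" and s0: "norm_sq s \<noteq> 0"
    and lam: "0 \<le> \<theta>" "\<theta> \<le> 1"
    and f: "\<And>i. i < n \<Longrightarrow> row P i \<bullet> s = f i - \<beta>"
    and D': "D' \<in> carrier_mat n n"
    and D'_index: "\<And>i j. i < n \<Longrightarrow> j < n \<Longrightarrow>
      D' $$ (i, j) = D $$ (i, j) + \<theta> * ((g i - g j)\<^sup>2 - (f i - f j)\<^sup>2) / norm_sq s"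
  shows "is_edm n D'"
proof -
  define N where "N = norm_sq s"
  have N: "N > 0" using s0 norm_sq_nonneg[of s] by (simp add: N_def)
  define \<mu> where "\<mu> = (1 - sqrt (1 - \<theta>)) / N"
  define \<nu> where "\<nu> = sqrt (\<theta> / N)"
  define X where "X = mat n (r + 1) (\<lambda>(i, m).
    if m < r then P $$ (i, m) - \<mu> * (row P i \<bullet> s) * s $ m else \<nu> * g i)"
  have X: "X \<in> carrier_mat n (r + 1)" by (simp add: X_def)
  have \<nu>2: "\<nu>\<^sup>2 = \<theta> / N" using lam N by (simp add: \<nu>_def)
  have "\<mu> * N = 1 - sqrt (1 - \<theta>)" using N by (simp add: \<mu>_def)
  then have "(1 - \<mu> * N)\<^sup>2 = 1 - \<theta>" using lam by simp
  then have "(\<mu>\<^sup>2 * N - 2 * \<mu>) * N = - \<theta>" by (simp add: power2_eq_square algebra_simps)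
  then have \<mu>2: "\<mu>\<^sup>2 * N - 2 * \<mu> = - \<theta> / N" using N by (simp add: field_simps)
  have "D' $$ (i, j) = norm_sq (row X i - row X j)" if i: "i < n" and j: "j < n" for i j
  proof -
    define a where "a m = P $$ (i, m) - P $$ (j, m)" for m
    define \<sigma> where "\<sigma> = f i - f j"
    have ps: "row P h \<bullet> s = (\<Sum>m<r. P $$ (h, m) * s $ m)" if "h < n" for h
      using that P s by (simp add: scalar_prod_def atLeast0LessThan)
    have "(\<Sum>m<r. a m * s $ m) = row P i \<bullet> s - row P j \<bullet> s"
      by (simp add: ps i j a_def sum_subtractf[symmetric] algebra_simps)
    then have as: "(\<Sum>m<r. a m * s $ m) = \<sigma>" using i j by (simp add: f \<sigma>_def)
    have ss: "(\<Sum>m<r. (s $ m)\<^sup>2) = N" using s by (simp add: N_def norm_sq_eq_sum)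
    have Dij: "D $$ (i, j) = (\<Sum>m<r. (a m)\<^sup>2)"
      using gen P i j by (simp add: generates_edm_def norm_sq_eq_sum a_def)
    have "norm_sq (row X i - row X j) = (\<Sum>m<Suc r. (X $$ (i, m) - X $$ (j, m))\<^sup>2)"
      using X i j by (simp add: norm_sq_eq_sum del: sum.lessThan_Suc)
    also have "\<dots> = (\<Sum>m<r. (X $$ (i, m) - X $$ (j, m))\<^sup>2) + \<nu>\<^sup>2 * (g i - g j)\<^sup>2"
      using i j by (simp add: X_def power_mult_distrib[symmetric] algebra_simps)
    also have "(\<Sum>m<r. (X $$ (i, m) - X $$ (j, m))\<^sup>2)
        = (\<Sum>m<r. (a m)\<^sup>2 - 2 * \<mu> * \<sigma> * (a m * s $ m) + \<mu>\<^sup>2 * \<sigma>\<^sup>2 * (s $ m)\<^sup>2)"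
    proof (rule sum.cong)
      fix m assume "m \<in> {..<r}"
      then have "X $$ (i, m) - X $$ (j, m) = a m - \<mu> * \<sigma> * s $ m"
        using i j by (simp add: X_def f a_def \<sigma>_def algebra_simps)
      then show "(X $$ (i, m) - X $$ (j, m))\<^sup>2
          = (a m)\<^sup>2 - 2 * \<mu> * \<sigma> * (a m * s $ m) + \<mu>\<^sup>2 * \<sigma>\<^sup>2 * (s $ m)\<^sup>2"
        by (simp only:) (simp add: power2_eq_square algebra_simps)
    qed simp
    also have "\<dots> = D $$ (i, j) - 2 * \<mu> * \<sigma> * \<sigma> + \<mu>\<^sup>2 * \<sigma>\<^sup>2 * N"
      by (simp only: sum.distrib sum_subtractf sum_distrib_left[symmetric] as ss Dij)
    also have "\<dots> = D $$ (i, j) + (\<mu>\<^sup>2 * N - 2 * \<mu>) * \<sigma>\<^sup>2"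
      by (simp add: power2_eq_square algebra_simps)
    finally have "norm_sq (row X i - row X j)
        = D $$ (i, j) + \<theta> * ((g i - g j)\<^sup>2 - \<sigma>\<^sup>2) / N"
      unfolding \<mu>2 \<nu>2 by (simp add: right_diff_distrib diff_divide_distrib)
    then show ?thesis using i j by (simp add: D'_index \<sigma>_def N_def)
  qed
  then have "generates_edm X D'" using X D' by (auto simp: generates_edm_def)
  then show ?thesis using X unfolding is_edm_def by blast
qed

section \<open>Gale matrices\<close>

text \<open>The configuration matrix used to define a Gale matrix may differ from \<open>P\<close>. Both have the
  same Gram matrix, and a matrix \<open>A\<^sup>T\<close> has the same kernel as \<open>A A\<^sup>T\<close>
  (\<open>kernel_gram_eq\<close>), so the null space can be described by \<open>P\<close> as well.\<close>

lemma gale_mat_kernel: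
  assumes gale: "is_gale_mat n r D Z" and conf: "is_configuration_mat n r D P"
  shows gale_mat_col: "\<And>j. j < n - r - 1 \<Longrightarrow>
      P\<^sup>T *\<^sub>v col Z j = 0\<^sub>v r \<and> ones_vec n \<bullet> col Z j = 0"
    and gale_mat_span: "\<And>v. v \<in> carrier_vec n \<Longrightarrow> P\<^sup>T *\<^sub>v v = 0\<^sub>v r \<Longrightarrow> ones_vec n \<bullet> v = 0 \<Longrightarrow>
      \<exists>w \<in> carrier_vec (n - r - 1). v = Z *\<^sub>v w"
proof -
  obtain Q where Q: "is_configuration_mat n r D Q"
    and basis: "vectorspace.basis class_ring
        ((module_vec TYPE(real) n)
          \<lparr>carrier := mat_kernel (Q\<^sup>T @\<^sub>r mat_of_row (ones_vec n))\<rparr>) (set (cols Z))"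
    using gale unfolding is_gale_mat_def by blast
  have Z: "Z \<in> carrier_mat n (n - r - 1)" using gale by (simp add: is_gale_mat_def)
  have Pc: "P \<in> carrier_mat n r" and Qc: "Q \<in> carrier_mat n r"
    and PQ: "P * P\<^sup>T = Q * Q\<^sup>T"
    using conf Q by (auto simp: is_configuration_mat_def)
  define A where "A = Q\<^sup>T @\<^sub>r mat_of_row (ones_vec n)"
  have ones_mat: "mat_of_row (ones_vec n) \<in> carrier_mat 1 n"
    using mat_of_row_carrier(1)[OF ones_vec_carrier] .
  have Qt: "Q\<^sup>T \<in> carrier_mat r n" using Qc by simp
  have A: "A \<in> carrier_mat (r + 1) n"
    unfolding A_def by (rule carrier_append_rows[OF Qt ones_mat])
  have mem: "v \<in> mat_kernel A \<longleftrightarrow> v \<in> carrier_vec n \<and> P\<^sup>T *\<^sub>v v = 0\<^sub>v r \<and> ones_vec n \<bullet> v = 0" for v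
  proof (cases "v \<in> carrier_vec n")
    case True
    have "A *\<^sub>v v = (Q\<^sup>T *\<^sub>v v) @\<^sub>v (mat_of_row (ones_vec n) *\<^sub>v v)"
      unfolding A_def by (rule mat_mult_append[OF Qt ones_mat True])
    moreover have "0\<^sub>v (r + 1) = 0\<^sub>v r @\<^sub>v (0\<^sub>v 1 :: real vec)" by auto
    ultimately have "A *\<^sub>v v = 0\<^sub>v (r + 1) \<longleftrightarrow>
        Q\<^sup>T *\<^sub>v v = 0\<^sub>v r \<and> mat_of_row (ones_vec n) *\<^sub>v v = 0\<^sub>v 1"
      using append_vec_eq[of "Q\<^sup>T *\<^sub>v v" r "0\<^sub>v r"] Qc True by auto
    also have "mat_of_row (ones_vec n) *\<^sub>v v = 0\<^sub>v 1 \<longleftrightarrow> ones_vec n \<bullet> v = 0"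
      by (auto simp: vec_eq_iff)
    also have "Q\<^sup>T *\<^sub>v v = 0\<^sub>v r \<longleftrightarrow> P\<^sup>T *\<^sub>v v = 0\<^sub>v r"
      using kernel_gram_eq[OF Qc True] kernel_gram_eq[OF Pc True] PQ by simp
    finally show ?thesis using mat_kernel[OF A] True by auto
  qed (simp add: mat_kernel[OF A])
  interpret kernel "r + 1" n A by (unfold_locales, rule A)
  have sub: "set (cols Z) \<subseteq> mat_kernel A" and span: "span (set (cols Z)) = mat_kernel A"
    using basis unfolding A_def[symmetric] Ker.basis_def by auto
  show "P\<^sup>T *\<^sub>v col Z j = 0\<^sub>v r \<and> ones_vec n \<bullet> col Z j = 0" if "j < n - r - 1" for j
  proof -
    have "col Z j \<in> set (cols Z)" using that Z by (auto simp: cols_def)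
    then show ?thesis using sub mem by blast
  qed
  show "\<exists>w \<in> carrier_vec (n - r - 1). v = Z *\<^sub>v w"
    if v: "v \<in> carrier_vec n" "P\<^sup>T *\<^sub>v v = 0\<^sub>v r" "ones_vec n \<bullet> v = 0" for v
  proof -
    have colsZ: "set (cols Z) \<subseteq> carrier_vec n" using Z cols_dim by blast
    have "v \<in> span (set (cols Z))" using v mem span by blast
    then have "v \<in> NC.span_list (cols Z)"
      unfolding span_same[OF sub] NC.span_list_as_span[OF colsZ] .
    then obtain a where "v = NC.lincomb_list a (cols Z)" by (auto elim: NC.in_span_listE)
    also have "\<dots> = mat_of_cols n (cols Z) *\<^sub>v vec (length (cols Z)) a"
      by (rule NC.lincomb_list_as_mat_mult) (use colsZ in auto)
    also have "mat_of_cols n (cols Z) = Z" using Z by auto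
    finally have "v = Z *\<^sub>v vec (n - r - 1) a" using Z by simp
    then show ?thesis by (intro bexI[of _ "vec (n - r - 1) a"]) auto
  qed
qed

text \<open>Such a vector lies in the span of the columns of \<open>Z\<close> and is orthogonal to that span, hence to
  itself.\<close>

lemma gale_mat_orthogonal_complement:
  assumes gale: "is_gale_mat n r D Z" and conf: "is_configuration_mat n r D P"
    and v: "v \<in> carrier_vec n" and Pv: "P\<^sup>T *\<^sub>v v = 0\<^sub>v r" and ev: "ones_vec n \<bullet> v = 0"
    and Zv: "Z\<^sup>T *\<^sub>v v = 0\<^sub>v (n - r - 1)"
  shows "v = 0\<^sub>v n"
proof -
  have Z: "Z \<in> carrier_mat n (n - r - 1)" using gale by (simp add: is_gale_mat_def)
  obtain w where w: "w \<in> carrier_vec (n - r - 1)" and vw: "v = Z *\<^sub>v w"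
    using gale_mat_span[OF gale conf v Pv ev] by blast
  have "norm_sq v = v \<bullet> (Z *\<^sub>v w)" by (simp add: norm_sq_def vw[symmetric])
  also have "\<dots> = (Z\<^sup>T *\<^sub>v v) \<bullet> w" by (rule transpose_vec_mult_scalar[OF Z w v, symmetric])
  also have "\<dots> = 0" using w by (simp add: Zv)
  finally show ?thesis using norm_sq_eq_0_iff[OF v] by simp
qed

text \<open>The columns of \<open>P\<close>, \<open>e\<close> and \<open>Z\<close> number exactly \<open>n\<close>, and no nonzero vector is orthogonal to
  all of them. So the square matrix \<open>M\<close> with these rows is invertible, and \<open>P\<^sup>T\<close> is onto. If
  \<open>x = P\<^sup>T u\<close> and \<open>P x = 0\<close>, then \<open>x \<bullet> x = u \<bullet> P x = 0\<close>.\<close>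

lemma configuration_mat_injective:
  assumes rn: "r + 1 \<le> n"
    and gale: "is_gale_mat n r D Z" and conf: "is_configuration_mat n r D P"
    and x: "x \<in> carrier_vec r" and Px: "P *\<^sub>v x = 0\<^sub>v n"
  shows "x = 0\<^sub>v r"
proof -
  have Z: "Z \<in> carrier_mat n (n - r - 1)" using gale by (simp add: is_gale_mat_def)
  have P: "P \<in> carrier_mat n r" using conf by (simp add: is_configuration_mat_def)
  have Zt: "Z\<^sup>T \<in> carrier_mat (n - r - 1) n" and Pt: "P\<^sup>T \<in> carrier_mat r n" using Z P by auto
  have ones_mat: "mat_of_row (ones_vec n) \<in> carrier_mat 1 n"
    using mat_of_row_carrier(1)[OF ones_vec_carrier] .
  define L where "L = mat_of_row (ones_vec n) @\<^sub>r Z\<^sup>T"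
  define M where "M = P\<^sup>T @\<^sub>r L"
  have L: "L \<in> carrier_mat (1 + (n - r - 1)) n"
    unfolding L_def by (rule carrier_append_rows[OF ones_mat Zt])
  have dim: "r + (1 + (n - r - 1)) = n" using rn by simp
  have M: "M \<in> carrier_mat n n"
    using carrier_append_rows[OF Pt L] unfolding M_def dim .
  have Mv: "M *\<^sub>v v = (P\<^sup>T *\<^sub>v v) @\<^sub>v ((mat_of_row (ones_vec n) *\<^sub>v v) @\<^sub>v (Z\<^sup>T *\<^sub>v v))"
    if "v \<in> carrier_vec n" for v
    unfolding M_def L_def
    using mat_mult_append[OF Pt L that] mat_mult_append[OF ones_mat Zt that] by (simp add: L_def)
  have "det M \<noteq> 0"
  proof
    assume "det M = 0"
    then obtain v where v: "v \<in> carrier_vec n" "v \<noteq> 0\<^sub>v n" and Mv0: "M *\<^sub>v v = 0\<^sub>v n"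
      using det_0_iff_vec_prod_zero[OF M] by auto
    have "0\<^sub>v n = 0\<^sub>v r @\<^sub>v (0\<^sub>v 1 @\<^sub>v (0\<^sub>v (n - r - 1) :: real vec))"
      using rn by (auto simp: vec_eq_iff)
    then have "(P\<^sup>T *\<^sub>v v) @\<^sub>v ((mat_of_row (ones_vec n) *\<^sub>v v) @\<^sub>v (Z\<^sup>T *\<^sub>v v))
        = 0\<^sub>v r @\<^sub>v (0\<^sub>v 1 @\<^sub>v (0\<^sub>v (n - r - 1)))"
      using Mv0 Mv[OF v(1)] by simp
    moreover have "P\<^sup>T *\<^sub>v v \<in> carrier_vec r" "mat_of_row (ones_vec n) *\<^sub>v v \<in> carrier_vec 1"
      using Pt v mult_mat_vec_carrier[OF ones_mat v(1)] by auto
    ultimately have "P\<^sup>T *\<^sub>v v = 0\<^sub>v r" "mat_of_row (ones_vec n) *\<^sub>v v = 0\<^sub>v 1"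
      "Z\<^sup>T *\<^sub>v v = 0\<^sub>v (n - r - 1)"
      using append_vec_eq[of _ r "0\<^sub>v r"] append_vec_eq[of _ 1 "0\<^sub>v 1"] by auto
    moreover from this(2) have "ones_vec n \<bullet> v = 0" by (auto simp: vec_eq_iff)
    ultimately have "v = 0\<^sub>v n" using gale_mat_orthogonal_complement[OF gale conf v(1)] by simp
    then show False using v by simp
  qed
  from det_non_zero_imp_unit[OF M this, unfolded Units_def, of "()"]
  obtain B where B: "B \<in> carrier_mat n n" and MB: "M * B = 1\<^sub>m n"
    by (auto simp: ring_mat_def)
  define y where "y = x @\<^sub>v 0\<^sub>v (1 + (n - r - 1))"
  have y: "y \<in> carrier_vec n"
    using append_carrier_vec[OF x zero_carrier_vec[of "1 + (n - r - 1)"]] unfolding y_def dim .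
  define u where "u = B *\<^sub>v y"
  have u: "u \<in> carrier_vec n" using B y by (auto simp: u_def)
  have "M *\<^sub>v u = y"
    unfolding u_def assoc_mult_mat_vec[OF M B y, symmetric] MB using y by simp
  moreover have "P\<^sup>T *\<^sub>v u \<in> carrier_vec r" by (rule mult_mat_vec_carrier[OF Pt u])
  ultimately have "P\<^sup>T *\<^sub>v u = x"
    unfolding Mv[OF u] y_def using append_vec_eq[OF _ x] by blast
  then have "norm_sq x = (P\<^sup>T *\<^sub>v u) \<bullet> x" by (simp add: norm_sq_def)
  also have "\<dots> = u \<bullet> (P *\<^sub>v x)" by (rule transpose_vec_mult_scalar[OF P x u])
  also have "\<dots> = 0" using u by (simp add: Px)
  finally show ?thesis using norm_sq_eq_0_iff[OF x] by simp
qed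

lemma config_pinv_inverse:
  assumes P: "P \<in> carrier_mat n r"
    and inj: "\<And>x. x \<in> carrier_vec r \<Longrightarrow> P *\<^sub>v x = 0\<^sub>v n \<Longrightarrow> x = 0\<^sub>v r"
  obtains G where "G \<in> carrier_mat r r" "config_pinv P = P * G"
    "P\<^sup>T * P * G = 1\<^sub>m r" "G * (P\<^sup>T * P) = 1\<^sub>m r"
proof -
  have Pt: "P\<^sup>T \<in> carrier_mat r n" using P by simp
  have H: "P\<^sup>T * P \<in> carrier_mat r r" using P by auto
  have "det (P\<^sup>T * P) \<noteq> 0"
  proof
    assume "det (P\<^sup>T * P) = 0"
    then obtain x where x: "x \<in> carrier_vec r" "x \<noteq> 0\<^sub>v r" and "(P\<^sup>T * P) *\<^sub>v x = 0\<^sub>v r"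
      using det_0_iff_vec_prod_zero[OF H] by auto
    then have "P *\<^sub>v x = 0\<^sub>v n" using kernel_gram_eq[OF Pt x(1)] by simp
    then show False using inj x by blast
  qed
  then have unit: "P\<^sup>T * P \<in> Units (ring_mat TYPE(real) r ())"
    by (rule det_non_zero_imp_unit[OF H])
  then obtain G where G: "mat_inverse (P\<^sup>T * P) = Some G"
    using mat_inverse(1)[OF H, of "()"] by fastforce
  then show ?thesis
    using mat_inverse(2)[OF H G] by (intro that[of G]) (auto simp: config_pinv_def)
qed

text \<open>The inverse \<open>G\<close> of the symmetric matrix \<open>P\<^sup>T P\<close> is again symmetric. Hence the transpose of \<open>G\<close> is
  an inverse as well, which gives the third identity.\<close>

lemma config_pinv_properties:
  assumes P: "P \<in> carrier_mat n r"
    and inj: "\<And>x. x \<in> carrier_vec r \<Longrightarrow> P *\<^sub>v x = 0\<^sub>v n \<Longrightarrow> x = 0\<^sub>v r"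
  shows config_pinv_carrier: "config_pinv P \<in> carrier_mat n r"
    and transpose_mult_config_pinv: "P\<^sup>T * config_pinv P = 1\<^sub>m r"
    and gram_mult_transpose_config_pinv: "P\<^sup>T * P * (config_pinv P)\<^sup>T = P\<^sup>T"
    and transpose_config_pinv_kernel: "\<And>v. v \<in> carrier_vec n \<Longrightarrow> P\<^sup>T *\<^sub>v v = 0\<^sub>v r \<Longrightarrow>
      (config_pinv P)\<^sup>T *\<^sub>v v = 0\<^sub>v r"
proof -
  obtain G where G: "G \<in> carrier_mat r r" and S: "config_pinv P = P * G"
    and HG: "P\<^sup>T * P * G = 1\<^sub>m r" and GH: "G * (P\<^sup>T * P) = 1\<^sub>m r"
    using config_pinv_inverse[OF P inj] by blast
  have Pt: "P\<^sup>T \<in> carrier_mat r n" and Gt: "G\<^sup>T \<in> carrier_mat r r"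
    and H: "P\<^sup>T * P \<in> carrier_mat r r" using P G by auto
  show "config_pinv P \<in> carrier_mat n r" using P G by (simp add: S)
  show "P\<^sup>T * config_pinv P = 1\<^sub>m r"
    unfolding S using assoc_mult_mat[OF Pt P G] HG by simp
  have St: "(config_pinv P)\<^sup>T = G\<^sup>T * P\<^sup>T"
    unfolding S by (rule transpose_mult[OF P G])
  have Ht: "(P\<^sup>T * P)\<^sup>T = P\<^sup>T * P" using transpose_mult[OF Pt P] by simp
  have HGt: "P\<^sup>T * P * G\<^sup>T = 1\<^sub>m r"
    using transpose_mult[OF G H] unfolding GH Ht by simp
  show "P\<^sup>T * P * (config_pinv P)\<^sup>T = P\<^sup>T"
    unfolding St using assoc_mult_mat[OF H Gt Pt] HGt Pt by simp
  show "(config_pinv P)\<^sup>T *\<^sub>v v = 0\<^sub>v r" if "v \<in> carrier_vec n" "P\<^sup>T *\<^sub>v v = 0\<^sub>v r" for v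
    unfolding St using assoc_mult_mat_vec[OF Gt Pt that(1)] that(2) Gt by auto
qed

text \<open>The right-hand side is the orthogonal projection of \<open>d\<close> to the span of the columns of \<open>P\<close> and
  \<open>e\<close>. The residual \<open>v\<close> is orthogonal to all of these, and, like \<open>d\<close> and the projection, to the
  columns of \<open>Z\<close>, so it vanishes.\<close>

lemma gale_orthogonal_decomposition:
  assumes n: "n > 0" and rn: "r + 1 \<le> n"
    and gale: "is_gale_mat n r D Z" and conf: "is_configuration_mat n r D P"
    and cent: "P\<^sup>T *\<^sub>v ones_vec n = 0\<^sub>v r"
    and d: "d \<in> carrier_vec n" and Zd: "Z\<^sup>T *\<^sub>v d = 0\<^sub>v (n - r - 1)"
  shows "d = P *\<^sub>v ((config_pinv P)\<^sup>T *\<^sub>v d) + (ones_vec n \<bullet> d / n) \<cdot>\<^sub>v ones_vec n"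
proof -
  have P: "P \<in> carrier_mat n r" using conf by (simp add: is_configuration_mat_def)
  have Z: "Z \<in> carrier_mat n (n - r - 1)" using gale by (simp add: is_gale_mat_def)
  note inj = configuration_mat_injective[OF rn gale conf]
  define S where "S = config_pinv P"
  have S: "S \<in> carrier_mat n r" unfolding S_def by (rule config_pinv_carrier[OF P inj])
  have Pt: "P\<^sup>T \<in> carrier_mat r n" and St: "S\<^sup>T \<in> carrier_mat r n"
    and Zt: "Z\<^sup>T \<in> carrier_mat (n - r - 1) n" using P S Z by auto
  define s where "s = S\<^sup>T *\<^sub>v d"
  have s: "s \<in> carrier_vec r" using St d by (auto simp: s_def)
  define \<beta> where "\<beta> = ones_vec n \<bullet> d / n"
  define v where "v = d - (P *\<^sub>v s + \<beta> \<cdot>\<^sub>v ones_vec n)"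
  have Ps: "P *\<^sub>v s \<in> carrier_vec n" using P s by auto
  have be: "\<beta> \<cdot>\<^sub>v ones_vec n \<in> carrier_vec n" by simp
  have pe: "P *\<^sub>v s + \<beta> \<cdot>\<^sub>v ones_vec n \<in> carrier_vec n" using Ps by simp
  have v: "v \<in> carrier_vec n" using d Ps by (auto simp: v_def)
  have expand: "A *\<^sub>v v = A *\<^sub>v d - (A *\<^sub>v (P *\<^sub>v s) + \<beta> \<cdot>\<^sub>v (A *\<^sub>v ones_vec n))"
    if A: "A \<in> carrier_mat m n" for A m
    unfolding v_def mult_minus_distrib_mat_vec[OF A d pe] mult_add_distrib_mat_vec[OF A Ps be]
      mult_mat_vec[OF A ones_vec_carrier] ..
  have "P\<^sup>T *\<^sub>v (P *\<^sub>v s) = P\<^sup>T *\<^sub>v d"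
  proof -
    have PP: "P\<^sup>T * P \<in> carrier_mat r r" using P by auto
    have "P\<^sup>T *\<^sub>v (P *\<^sub>v s) = (P\<^sup>T * P) *\<^sub>v (S\<^sup>T *\<^sub>v d)"
      using assoc_mult_mat_vec[OF Pt P s] by (simp add: s_def)
    also have "\<dots> = (P\<^sup>T * P * S\<^sup>T) *\<^sub>v d" using assoc_mult_mat_vec[OF PP St d] by simp
    also have "P\<^sup>T * P * S\<^sup>T = P\<^sup>T"
      unfolding S_def by (rule gram_mult_transpose_config_pinv[OF P inj])
    finally show ?thesis .
  qed
  then have Pv: "P\<^sup>T *\<^sub>v v = 0\<^sub>v r"
    unfolding expand[OF Pt] cent using Pt d by auto
  have "Z\<^sup>T *\<^sub>v ones_vec n = 0\<^sub>v (n - r - 1)"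
    using gale_mat_col[OF gale conf] Z
    by (auto simp: vec_eq_iff comm_scalar_prod[OF _ ones_vec_carrier])
  moreover have "Z\<^sup>T *\<^sub>v (P *\<^sub>v s) = 0\<^sub>v (n - r - 1)"
  proof (rule eq_vecI)
    fix j assume "j < dim_vec (0\<^sub>v (n - r - 1))"
    then have j: "j < n - r - 1" by simp
    then have c: "col Z j \<in> carrier_vec n" using Z by auto
    have "col Z j \<bullet> (P *\<^sub>v s) = (P\<^sup>T *\<^sub>v col Z j) \<bullet> s"
      by (rule transpose_vec_mult_scalar[OF P s c, symmetric])
    also have "\<dots> = 0" using gale_mat_col[OF gale conf j] s by simp
    finally show "(Z\<^sup>T *\<^sub>v (P *\<^sub>v s)) $ j = 0\<^sub>v (n - r - 1) $ j" using Z j by simp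
  qed (use Z in simp)
  ultimately have Zv: "Z\<^sup>T *\<^sub>v v = 0\<^sub>v (n - r - 1)"
    unfolding expand[OF Zt] Zd by auto
  have "ones_vec n \<bullet> (P *\<^sub>v s) = (P\<^sup>T *\<^sub>v ones_vec n) \<bullet> s"
    by (rule transpose_vec_mult_scalar[OF P s ones_vec_carrier, symmetric])
  also have "\<dots> = 0" using s by (simp add: cent)
  finally have "ones_vec n \<bullet> (P *\<^sub>v s) = 0" .
  moreover have "ones_vec n \<bullet> ones_vec n = real n"
    by (simp add: ones_vec_scalar_prod) (simp add: ones_vec_def)
  ultimately have ev: "ones_vec n \<bullet> v = 0"
    unfolding v_def using d Ps n
    by (simp add: scalar_prod_minus_distrib[of _ n] scalar_prod_add_distrib[of _ n] \<beta>_def)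
  have "v = 0\<^sub>v n" by (rule gale_mat_orthogonal_complement[OF gale conf v Pv ev Zv])
  then have "d = P *\<^sub>v s + \<beta> \<cdot>\<^sub>v ones_vec n"
    using d Ps unfolding v_def by (auto simp: vec_eq_iff ones_vec_def)
  then show ?thesis by (simp add: s_def S_def \<beta>_def)
qed


section \<open>Parallel Gale vectors\<close>

lemma transpose_mult_unit_vec_diff:
  fixes A :: "real mat"
  assumes A: "A \<in> carrier_mat n m" and "k < n" "l < n"
  shows "A\<^sup>T *\<^sub>v (unit_vec n k - c \<cdot>\<^sub>v unit_vec n l) = row A k - c \<cdot>\<^sub>v row A l"
proof (rule eq_vecI)
  fix j assume "j < dim_vec (row A k - c \<cdot>\<^sub>v row A l)"
  then have j: "j < m" using A by simp
  then have "col A j \<in> carrier_vec n" using A by auto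
  then show "(A\<^sup>T *\<^sub>v (unit_vec n k - c \<cdot>\<^sub>v unit_vec n l)) $ j = (row A k - c \<cdot>\<^sub>v row A l) $ j"
    using assms j by (simp add: scalar_prod_minus_distrib[of _ n])
qed (use A in simp)

text \<open>The quantity \<open>- t N / (4 c)\<close> measures how much of the component of the configuration along \<open>s\<close>
  is traded for the new coordinate. It must lie between nothing and everything.

  The vector \<open>s\<close> is nonzero since otherwise \<open>d\<close> would be a multiple of \<open>e\<close>; with at least three
  indices, \<open>d\<close> has a zero entry, while its \<open>k\<close>-th entry is \<open>1\<close>.\<close>

lemma edm_perturbation_iff:
  fixes c t :: real
  assumes n: "n \<ge> 3" and rn: "r + 1 \<le> n"
    and edm: "is_edm n D"
    and gale: "is_gale_mat n r D Z" and conf: "is_configuration_mat n r D P"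
    and cent: "P\<^sup>T *\<^sub>v ones_vec n = 0\<^sub>v r"
    and kl: "k < n" "l < n" "k \<noteq> l"
    and zl: "row Z l \<noteq> 0\<^sub>v (n - r - 1)"
    and c: "c \<noteq> 0" and zk: "row Z k = c \<cdot>\<^sub>v row Z l"
  defines "N \<equiv> norm_sq (row (config_pinv P) k - c \<cdot>\<^sub>v row (config_pinv P) l)"
  shows "N > 0"
    and "is_edm n (D + t \<cdot>\<^sub>m sym_unit_mat n k l) \<longleftrightarrow> 0 \<le> - t * N / (4 * c) \<and> - t * N / (4 * c) \<le> 1"
proof -
  have P: "P \<in> carrier_mat n r" using conf by (simp add: is_configuration_mat_def)
  have Z: "Z \<in> carrier_mat n (n - r - 1)" using gale by (simp add: is_gale_mat_def)
  have gen: "generates_edm P D" by (rule configuration_mat_generates_edm[OF edm conf])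
  have D: "D \<in> carrier_mat n n" using gen P by (simp add: generates_edm_def)
  note inj = configuration_mat_injective[OF rn gale conf]
  define S where "S = config_pinv P"
  have S: "S \<in> carrier_mat n r" unfolding S_def by (rule config_pinv_carrier[OF P inj])
  have Pt: "P\<^sup>T \<in> carrier_mat r n" using P by simp
  define d where "d = unit_vec n k - c \<cdot>\<^sub>v unit_vec n l"
  have d: "d \<in> carrier_vec n" by (simp add: d_def)
  have d_index: "d $ i = of_bool (i = k) - c * of_bool (i = l)" if "i < n" for i
    using that kl by (simp add: d_def)
  define s where "s = row S k - c \<cdot>\<^sub>v row S l"
  have s: "s \<in> carrier_vec r" using S by (auto simp: s_def)
  have Ns: "N = norm_sq s" by (simp add: N_def s_def S_def)
  have Std: "S\<^sup>T *\<^sub>v d = s"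
    unfolding d_def s_def by (rule transpose_mult_unit_vec_diff[OF S kl(1,2)])
  have "Z\<^sup>T *\<^sub>v d = row Z k - c \<cdot>\<^sub>v row Z l"
    unfolding d_def by (rule transpose_mult_unit_vec_diff[OF Z kl(1,2)])
  also have "\<dots> = 0\<^sub>v (n - r - 1)" using Z by (auto simp: zk)
  finally have Zd: "Z\<^sup>T *\<^sub>v d = 0\<^sub>v (n - r - 1)" .
  define \<beta> where "\<beta> = ones_vec n \<bullet> d / n"
  have decomp: "d = P *\<^sub>v s + \<beta> \<cdot>\<^sub>v ones_vec n"
    using gale_orthogonal_decomposition[OF _ rn gale conf cent d Zd] n
    by (simp add: S_def[symmetric] Std \<beta>_def)
  have Ps: "row P i \<bullet> s = d $ i - \<beta>" if "i < n" for i
    using that P by (subst decomp) (simp add: ones_vec_def)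
  have "s \<noteq> 0\<^sub>v r"
  proof
    assume "s = 0\<^sub>v r"
    then have const: "d $ i = \<beta>" if "i < n" for i using Ps[OF that] that P by simp
    have "card ({..<n} - {k, l}) > 0" using n kl by (simp add: card_Diff_subset)
    then obtain h where "h < n" "h \<noteq> k" "h \<noteq> l" by (auto simp: card_gt_0_iff)
    then show False using const[of h] const[of k] kl d_index[of h] d_index[of k] by simp
  qed
  then show N: "N > 0"
    using norm_sq_nonneg[of s] norm_sq_eq_0_iff[OF s] by (simp add: Ns)
  show "is_edm n (D + t \<cdot>\<^sub>m sym_unit_mat n k l) \<longleftrightarrow> 0 \<le> - t * N / (4 * c) \<and> - t * N / (4 * c) \<le> 1"
  proof
    assume edm_t: "is_edm n (D + t \<cdot>\<^sub>m sym_unit_mat n k l)"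
    note test = perturbed_edm_necessary[OF P gen kl edm_t]
    \<comment> \<open>A column of \<open>Z\<close> that does not vanish at \<open>l\<close> tests the sign of \<open>t c\<close>.\<close>
    obtain j where j: "j < n - r - 1" and zj: "Z $$ (l, j) \<noteq> 0"
      using zl Z kl by (auto simp: vec_eq_iff)
    define z where "z = col Z j"
    have z: "z \<in> carrier_vec n" using Z j by (auto simp: z_def)
    have Pz: "P\<^sup>T *\<^sub>v z = 0\<^sub>v r" and ez: "ones_vec n \<bullet> z = 0"
      using gale_mat_col[OF gale conf j] by (auto simp: z_def)
    have z_l: "z $ l \<noteq> 0" using zj Z j kl by (simp add: z_def)
    have z_k: "z $ k = c * z $ l"
      using arg_cong[OF zk, of "\<lambda>v. v $ j"] Z j kl by (simp add: z_def)
    have "t * c * (z $ l)\<^sup>2 \<le> 0"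
      using test[OF z ez] by (simp add: Pz z_k norm_sq_def power2_eq_square mult_ac)
    then have tc: "t * c \<le> 0" using z_l by (simp add: mult_le_0_iff)
    have "- t * N / (4 * c) = - (t * c) * N / (4 * c\<^sup>2)"
      using c by (simp add: power2_eq_square)
    then have lower: "0 \<le> - t * N / (4 * c)"
      using tc N by (simp add: divide_nonpos_nonneg mult_nonpos_nonneg)
    \<comment> \<open>Equality in the second bound needs \<open>P\<^sup>T x\<close> parallel to \<open>s\<close> and \<open>x\<^sub>k + c x\<^sub>l = 0\<close>. The vector \<open>S s\<close>
      has the first property, and adding a multiple of \<open>z\<close> preserves it and achieves the second.\<close>
    define y where "y = S *\<^sub>v s"
    have y: "y \<in> carrier_vec n" using S s by (auto simp: y_def)
    have Py: "P\<^sup>T *\<^sub>v y = s"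
      using assoc_mult_mat_vec[OF Pt S s] transpose_mult_config_pinv[OF P inj] s
      by (simp add: y_def S_def)
    have "ones_vec n \<bullet> y = (S\<^sup>T *\<^sub>v ones_vec n) \<bullet> s"
      unfolding y_def by (rule transpose_vec_mult_scalar[OF S s ones_vec_carrier, symmetric])
    also have "S\<^sup>T *\<^sub>v ones_vec n = 0\<^sub>v r"
      unfolding S_def by (rule transpose_config_pinv_kernel[OF P inj ones_vec_carrier cent])
    finally have ey: "ones_vec n \<bullet> y = 0" using s by simp
    define \<alpha> where "\<alpha> = - (y $ k + c * y $ l) / (2 * c * z $ l)"
    define x where "x = y + \<alpha> \<cdot>\<^sub>v z"
    have x: "x \<in> carrier_vec n" using y z by (simp add: x_def)
    have "\<alpha> \<cdot>\<^sub>v 0\<^sub>v r = 0\<^sub>v r" by (rule eq_vecI) auto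
    then have Px: "P\<^sup>T *\<^sub>v x = s"
      using mult_add_distrib_mat_vec[OF Pt y, of "\<alpha> \<cdot>\<^sub>v z"] mult_mat_vec[OF Pt z] Py Pz z s
      by (simp add: x_def)
    have ex: "ones_vec n \<bullet> x = 0"
      using y z ey ez by (simp add: x_def scalar_prod_add_distrib[of _ n])
    have "x $ k + c * x $ l = y $ k + c * y $ l + \<alpha> * (2 * c * z $ l)"
      using y z kl by (simp add: x_def z_k algebra_simps)
    also have "\<dots> = 0" using c z_l by (simp add: \<alpha>_def)
    finally have plus: "x $ k + c * x $ l = 0" .
    have "x $ k - c * x $ l = d \<bullet> x"
      using x kl unfolding d_def
      by (simp add: minus_scalar_prod_distrib[of _ n])
    also have "\<dots> = (P *\<^sub>v s) \<bullet> x + \<beta> * (ones_vec n \<bullet> x)"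
      using P s x by (subst decomp) (simp add: add_scalar_prod_distrib[of _ n])
    also have "(P *\<^sub>v s) \<bullet> x = (P\<^sup>T *\<^sub>v x) \<bullet> s"
      using transpose_vec_mult_scalar[OF P s x] comm_scalar_prod[OF x, of "P *\<^sub>v s"] P s by simp
    finally have minus: "x $ k - c * x $ l = N" by (simp add: Px ex Ns norm_sq_def)
    have xk: "x $ k = N / 2" and xl: "x $ l = - N / (2 * c)"
      using plus minus c by (auto simp: field_simps)
    have "t * (N / 2 * (- N / (2 * c))) \<le> N"
      using test[OF x ex] unfolding xk xl Px Ns[symmetric] .
    then have "(- t * N / (4 * c)) * N \<le> 1 * N" by (simp add: field_simps)
    then have "- t * N / (4 * c) \<le> 1" using N by (rule mult_right_le_imp_le)
    with lower show "0 \<le> - t * N / (4 * c) \<and> - t * N / (4 * c) \<le> 1" ..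
  next
    define \<theta> where "\<theta> = - t * N / (4 * c)"
    assume "0 \<le> - t * N / (4 * c) \<and> - t * N / (4 * c) \<le> 1"
    then have \<theta>: "0 \<le> \<theta>" "\<theta> \<le> 1" by (auto simp: \<theta>_def)
    have t: "t = - 4 * c * \<theta> / N" using N c by (simp add: \<theta>_def)
    \<comment> \<open>With \<open>g\<close> being \<open>d\<close> with the sign of \<open>c\<close> reversed, the difference of the squared increments is
      \<open>4 c\<close> times the product of the increments of the two indicators, which is \<open>-1\<close> exactly at the
      entries \<open>(k, l)\<close> and \<open>(l, k)\<close>, and \<open>0\<close> elsewhere.\<close>
    define g where "g i = of_bool (i = k) + c * of_bool (i = l)" for i
    show "is_edm n (D + t \<cdot>\<^sub>m sym_unit_mat n k l)"
    proof (rule exchange_coordinate_edm[OF P gen s _ \<theta> Ps])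
      show "norm_sq s \<noteq> 0" using N by (simp add: Ns)
      show "D + t \<cdot>\<^sub>m sym_unit_mat n k l \<in> carrier_mat n n"
        using D by (simp add: sym_unit_mat_def)
      fix i j assume i: "i < n" and j: "j < n"
      have "(g i - g j)\<^sup>2 - (d $ i - d $ j)\<^sup>2 = - 4 * c * sym_unit_mat n k l $$ (i, j)"
        using i j kl by (auto simp: g_def d_index sym_unit_mat_def power2_eq_square algebra_simps)
      then show "(D + t \<cdot>\<^sub>m sym_unit_mat n k l) $$ (i, j)
          = D $$ (i, j) + \<theta> * ((g i - g j)\<^sup>2 - (d $ i - d $ j)\<^sup>2) / norm_sq s"
        using i j D by (simp add: t Ns[symmetric]) (simp add: sym_unit_mat_def)
    qed
  qed
qed

theorem theorem4p3:
  fixes n r k l :: nat and c :: real and D P Z S :: "real mat"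
  assumes "n \<ge> 3"
    and "is_edm n D"
    and "has_embedding_dim D r"
    and "r \<le> n - 2"
    and "is_gale_mat n r D Z"
    and "is_configuration_mat n r D P"
    and "transpose_mat P *\<^sub>v ones_vec n = 0\<^sub>v r"
    and "S = config_pinv P"
    and "k < n" and "l < n" and "k \<noteq> l"
    and "row Z k \<noteq> 0\<^sub>v (n - r - 1)" and "row Z l \<noteq> 0\<^sub>v (n - r - 1)"
    and "c \<noteq> 0" and "row Z k = c \<cdot>\<^sub>v row Z l"
  shows "(c > 0 \<longrightarrow>
            is_yielding_interval n D k l (- 4 * c / norm_sq (row S k - c \<cdot>\<^sub>v row S l)) 0) \<and>
         (c < 0 \<longrightarrow>
            is_yielding_interval n D k l 0 (4 * \<bar>c\<bar> / norm_sq (row S k - c \<cdot>\<^sub>v row S l)))"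
proof -
  define N where "N = norm_sq (row S k - c \<cdot>\<^sub>v row S l)"
  have "r + 1 \<le> n" using assms(1,4) by simp
  note iff = edm_perturbation_iff[OF assms(1) this assms(2,5,6,7,9,10,11,13,14,15),
      folded \<open>S = config_pinv P\<close>, folded N_def]
  have "is_yielding_interval n D k l (- 4 * c / N) 0" if "c > 0"
    unfolding is_yielding_interval_def iff(2) using that iff(1)
    by (auto simp: field_simps zero_le_mult_iff mult_le_0_iff)
  moreover have "is_yielding_interval n D k l 0 (4 * \<bar>c\<bar> / N)" if "c < 0"
    unfolding is_yielding_interval_def iff(2) using that iff(1)
    by (auto simp: field_simps zero_le_mult_iff mult_le_0_iff)
  ultimately show ?thesis unfolding N_def by blast
qed

end
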